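(* Let $g = d\nu$ be a probability density function on $\mathbb{R}^d$ with finite second moment, compactly supported on a convex domain $Y\subseteq\mathbb{R}^d$. For $\Theta=\{s_1,\dots,s_d,\lambda_1,\dots,\lambda_d\}$ with $s_k\in\mathbb{R}$ and $\lambda_k\in\mathbb{R}^+=(0,\infty)$ for $k=1,\dots,d$, let $A=\mathrm{diag}(1/\lambda_1,\dots,1/\lambda_d)$, let $\{e_k\}_{k=1}^d$ be the standard basis of $\mathbb{R}^d$, and define $$f_\Theta(x)=\det(A)\, g\Bigl(A\Bigl(x-\sum_{k=1}^d s_k e_k\Bigr)\Bigr).$$ Then the optimal transport map (for the quadratic cost $|x-y|^2$) between $f_\Theta(x)$ and $g(y)$ is $y=T_\Theta(x)$, where $$\langle T_\Theta(x),e_k\rangle=\frac{1}{\lambda_k}\bigl(\langle x,e_k\rangle-s_k\bigr),\qquad k=1,\dots,d.$$ Moreover, $I(\Theta)=W_2^2(f_\Theta,g)$ is a strictly convex function of the multivariable $\Theta\in\mathbb{R}^d\times(0,\infty)^d\subset\mathbb{R}^{2d}$.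
   Context: For probability measures $\mu,\nu$ on $\mathbb{R}^d$ with finite second moments, $\mu$ absolutely continuous, $W_2^2(\mu,\nu)=\inf_{T:\,T_\#\mu=\nu}\int_{\mathbb{R}^d}|x-T(x)|^2\,d\mu(x)$, where $T_\#\mu=\nu$ means $\mu(T^{-1}(B))=\nu(B)$ for all measurable $B$; a minimizer $T$ is called the optimal transport map from $\mu$ to $\nu$ (it is unique $\mu$-a.e.). For densities, $W_2(f,g)$ denotes the $W_2$ distance between the measures with densities $f$ and $g$. $|\cdot|$ is the Euclidean norm and $\langle\cdot,\cdot\rangle$ the Euclidean inner product. *)

theory Defs
  imports "HOL-Analysis.Analysis"
begin

definition transport_map :: "'a measure \<Rightarrow> 'b measure \<Rightarrow> ('a \<Rightarrow> 'b) \<Rightarrow> bool" where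
  "transport_map \<mu> \<nu> T \<longleftrightarrow> T \<in> measurable \<mu> \<nu> \<and> distr \<mu> \<nu> T = \<nu>"

definition transport_cost :: "'a::euclidean_space measure \<Rightarrow> ('a \<Rightarrow> 'a) \<Rightarrow> ennreal" where
  "transport_cost \<mu> T = (\<integral>\<^sup>+ x. ennreal ((norm (x - T x))\<^sup>2) \<partial>\<mu>)"

definition optimal_transport_map ::
    "'a::euclidean_space measure \<Rightarrow> 'a measure \<Rightarrow> ('a \<Rightarrow> 'a) \<Rightarrow> bool" where
  "optimal_transport_map \<mu> \<nu> T \<longleftrightarrow>
     transport_map \<mu> \<nu> T \<and>
     (\<forall>T'. transport_map \<mu> \<nu> T' \<longrightarrow> transport_cost \<mu> T \<le> transport_cost \<mu> T')"

(* The Monge form of the 2-Wasserstein distance, appropriate for absolutely continuous \<mu>.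
   The infimum is taken in [0, \<infinity>]; for finite second moments (and some transport map) it is
   finite, so that enn2real (which sends \<infinity> to 0) loses nothing. *)
definition wasserstein2 :: "'a::euclidean_space measure \<Rightarrow> 'a measure \<Rightarrow> real" where
  "wasserstein2 \<mu> \<nu> =
     sqrt (enn2real (INF T \<in> {T. transport_map \<mu> \<nu> T}. transport_cost \<mu> T))"

definition density_measure :: "('a::euclidean_space \<Rightarrow> real) \<Rightarrow> 'a measure" where
  "density_measure f = density lborel (\<lambda>x. ennreal (f x))"

definition prob_density :: "('a::euclidean_space \<Rightarrow> real) \<Rightarrow> bool" where
  "prob_density f \<longleftrightarrow>
     f \<in> borel_measurable borel \<and> (\<forall>x. 0 \<le> f x) \<and> (\<integral>\<^sup>+ x. ennreal (f x) \<partial>lborel) = 1"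

definition finite_second_moment :: "('a::euclidean_space \<Rightarrow> real) \<Rightarrow> bool" where
  "finite_second_moment f \<longleftrightarrow> integrable lborel (\<lambda>x. (norm x)\<^sup>2 * f x)"

(* A parameter \<Theta> is a pair (s, \<lambda>) of vectors. *)
definition parameters :: "((real ^ 'd) \<times> (real ^ 'd)) set" where
  "parameters = UNIV \<times> {l. \<forall>k. 0 < l $ k}"

definition scaling_matrix :: "real ^ 'd \<Rightarrow> real ^ 'd ^ 'd" where
  "scaling_matrix l = (\<chi> i j. if i = j then 1 / l $ i else 0)"

definition rescaled_density ::
    "(real ^ 'd \<Rightarrow> real) \<Rightarrow> (real ^ 'd) \<times> (real ^ 'd) \<Rightarrow> real ^ 'd \<Rightarrow> real" where
  "rescaled_density g \<Theta> x =
     (let s = fst \<Theta>; A = scaling_matrix (snd \<Theta>)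
      in det A * g (A *v (x - (\<Sum>k\<in>UNIV. s $ k *\<^sub>R axis k 1))))"

definition rescaling_map :: "(real ^ 'd) \<times> (real ^ 'd) \<Rightarrow> real ^ 'd \<Rightarrow> real ^ 'd" where
  "rescaling_map \<Theta> x = (\<chi> k. 1 / snd \<Theta> $ k * (inner x (axis k 1) - fst \<Theta> $ k))"

definition strictly_convex_on :: "'a::real_vector set \<Rightarrow> ('a \<Rightarrow> real) \<Rightarrow> bool" where
  "strictly_convex_on S f \<longleftrightarrow>
     convex S \<and>
     (\<forall>x\<in>S. \<forall>y\<in>S. \<forall>t. x \<noteq> y \<and> 0 < t \<and> t < 1 \<longrightarrow>
        f ((1 - t) *\<^sub>R x + t *\<^sub>R y) < (1 - t) * f x + t * f y)"

end

theory Submission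
  imports Defs
begin

text \<open>
  Put \<open>S y = (\<lambda>\<^sub>k y\<^sub>k + s\<^sub>k)\<^sub>k\<close>, so that \<open>f\<^sub>\<Theta>\<close> is the density of the image of \<open>\<nu>\<close> under \<open>S\<close> and
  \<open>T\<^sub>\<Theta> = S\<^sup>-\<^sup>1\<close> is the gradient of \<open>\<phi>(x) = \<Sum>\<^sub>k (x\<^sub>k - s\<^sub>k)\<^sup>2 / (2 \<lambda>\<^sub>k)\<close>. With the Legendre transform
  \<open>\<phi>*(y) = \<Sum>\<^sub>k (\<lambda>\<^sub>k y\<^sub>k\<^sup>2 / 2 + s\<^sub>k y\<^sub>k)\<close>, the defect in the Fenchel inequality is explicit:
  \<open>\<phi>(x) + \<phi>*(y) - \<langle>x, y\<rangle> = \<Sum>\<^sub>k \<lambda>\<^sub>k ((T\<^sub>\<Theta> x)\<^sub>k - y\<^sub>k)\<^sup>2 / 2\<close>.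
  Integrating it at \<open>y = T x\<close>, the cost of any transport map \<open>T\<close> is a constant plus the
  nonnegative integral of the defect, which vanishes precisely when \<open>T = T\<^sub>\<Theta>\<close> almost everywhere.
  Hence \<open>I(\<Theta>) = \<integral> |S y - y|\<^sup>2 d\<nu>\<close>, a quadratic function of \<open>\<Theta>\<close> with quadratic part
  \<open>\<integral> \<Sum>\<^sub>k (\<lambda>\<^sub>k y\<^sub>k + s\<^sub>k)\<^sup>2 d\<nu>\<close>; this is positive for \<open>\<Theta> \<noteq> 0\<close> because \<open>\<nu>\<close> does not charge
  hyperplanes.
\<close>

section \<open>The inverse of the rescaling map\<close>

text \<open>For fixed \<open>y\<close> this is linear in \<open>\<Theta>\<close>. It is later
  evaluated outside \<open>parameters\<close> as well, at differences such as
  \<open>\<Theta> - \<Theta>'\<close>.\<close>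

definition stretch :: "(real ^ 'd) \<times> (real ^ 'd) \<Rightarrow> real ^ 'd \<Rightarrow> real ^ 'd" where
  "stretch \<Theta> y = (\<chi> k. snd \<Theta> $ k * y $ k + fst \<Theta> $ k)"

lemma stretch_nth [simp]: "stretch \<Theta> y $ k = snd \<Theta> $ k * y $ k + fst \<Theta> $ k"
  by (simp add: stretch_def)

lemma rescaling_map_nth [simp]: "rescaling_map \<Theta> x $ k = (x $ k - fst \<Theta> $ k) / snd \<Theta> $ k"
  by (simp add: rescaling_map_def inner_axis)

lemma parameters_pos: "\<Theta> \<in> parameters \<Longrightarrow> 0 < snd \<Theta> $ k"
  by (auto simp: parameters_def)

lemma rescaling_map_stretch: "\<Theta> \<in> parameters \<Longrightarrow> rescaling_map \<Theta> (stretch \<Theta> y) = y"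
  using parameters_pos[of \<Theta>] by (simp add: vec_eq_iff less_imp_neq[symmetric])

lemma borel_measurable_vec_nth [measurable (raw)]:
  fixes f :: "'a \<Rightarrow> real ^ 'd"
  assumes "f \<in> borel_measurable M"
  shows "(\<lambda>x. f x $ k) \<in> borel_measurable M"
  using assms unfolding cart_eq_inner_axis by simp

lemma borel_measurable_stretch [measurable]: "stretch \<Theta> \<in> borel_measurable borel"
  unfolding stretch_def by (intro borel_measurable_continuous_onI continuous_intros)

lemma borel_measurable_rescaling_map [measurable]: "rescaling_map \<Theta> \<in> borel_measurable borel"
  unfolding rescaling_map_def by (intro borel_measurable_continuous_onI continuous_intros)

lemma norm_power2_vec: "(norm x)\<^sup>2 = (\<Sum>k\<in>UNIV. (x $ k)\<^sup>2)" for x :: "real ^ 'd"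
  unfolding power2_norm_eq_inner inner_vec_def by (simp add: power2_eq_square)

lemma sets_density_measure [simp, measurable_cong]: "sets (density_measure f) = sets borel"
  by (simp add: density_measure_def)

lemma space_density_measure [simp]: "space (density_measure f) = UNIV"
  by (simp add: density_measure_def)

lemma emeasure_density_measure_UNIV: "prob_density g \<Longrightarrow> emeasure (density_measure g) UNIV = 1"
  unfolding density_measure_def prob_density_def by (simp add: emeasure_density)

section \<open>The rescaled density as the density of an image measure\<close>

lemma rescaled_density_eq:
  "rescaled_density g \<Theta> x = (\<Prod>k\<in>UNIV. 1 / snd \<Theta> $ k) * g (rescaling_map \<Theta> x)"
proof -
  have "(\<Sum>k\<in>UNIV. fst \<Theta> $ k *\<^sub>R axis k 1) = fst \<Theta>"
    using basis_expansion[of "fst \<Theta>"] by (simp add: scalar_mult_eq_scaleR)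
  moreover have "scaling_matrix (snd \<Theta>) *v (x - fst \<Theta>) = rescaling_map \<Theta> x"
    by (simp add: vec_eq_iff scaling_matrix_def matrix_vector_mult_def if_distrib[where f="\<lambda>a. a * _"] cong: if_cong)
  moreover have "det (scaling_matrix (snd \<Theta>)) = (\<Prod>k\<in>UNIV. 1 / snd \<Theta> $ k)"
    by (subst det_diagonal) (auto simp: scaling_matrix_def)
  ultimately show ?thesis
    by (simp add: rescaled_density_def)
qed

text \<open>Turns the Jacobian factor of \<open>lborel_affine_euclidean\<close>, a product over
  \<open>Basis\<close>, into a product over coordinates.\<close>

lemma prod_Basis_vec: "(\<Prod>b\<in>Basis. f (x \<bullet> b)) = (\<Prod>k\<in>UNIV. f (x $ k))"
  for x :: "real ^ 'd" and f :: "real \<Rightarrow> 'b::comm_monoid_mult"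
proof -
  have Basis: "Basis = range (\<lambda>k. axis k (1::real) :: real ^ 'd)"
    by (auto simp: Basis_vec_def)
  have "inj (\<lambda>k. axis k (1::real) :: real ^ 'd)"
    by (simp add: inj_on_def axis_eq_axis)
  then show ?thesis
    unfolding Basis by (subst prod.reindex) (simp_all add: o_def inner_axis)
qed

text \<open>Change of variables: \<open>stretch \<Theta>\<close> is affine with diagonal linear
  part, whose determinant is the product of the positive entries of
  \<open>snd \<Theta>\<close>.\<close>

lemma lborel_stretch:
  fixes \<Theta> :: "(real ^ 'd) \<times> (real ^ 'd)"
  assumes "\<Theta> \<in> parameters"
  shows "lborel = density (distr lborel borel (stretch \<Theta>)) (\<lambda>_. ennreal (\<Prod>k\<in>UNIV. snd \<Theta> $ k))"
proof -
  let ?c = "\<lambda>b. snd \<Theta> \<bullet> b"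
  have pos: "0 < ?c b" if "b \<in> Basis" for b
    using that parameters_pos[OF assms] by (auto simp: Basis_vec_def inner_axis)
  have "stretch \<Theta> = (\<lambda>x. fst \<Theta> + (\<Sum>j\<in>Basis. (?c j * (x \<bullet> j)) *\<^sub>R j))"
  proof
    fix x :: "real ^ 'd"
    show "stretch \<Theta> x = fst \<Theta> + (\<Sum>j\<in>Basis. (?c j * (x \<bullet> j)) *\<^sub>R j)"
    proof (rule euclidean_eqI)
      fix b :: "real ^ 'd" assume b: "b \<in> Basis"
      then obtain k where k: "b = axis k 1"
        by (auto simp: Basis_vec_def)
      have "(\<Sum>j\<in>Basis. (?c j * (x \<bullet> j)) *\<^sub>R j) \<bullet> b = ?c b * (x \<bullet> b)"
        using b by simp
      then show "stretch \<Theta> x \<bullet> b = (fst \<Theta> + (\<Sum>j\<in>Basis. (?c j * (x \<bullet> j)) *\<^sub>R j)) \<bullet> b"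
        by (simp add: k inner_axis inner_add_left)
    qed
  qed
  moreover have "(\<Prod>b\<in>Basis. \<bar>?c b\<bar>) = (\<Prod>k\<in>UNIV. snd \<Theta> $ k)"
    using parameters_pos[OF assms] by (subst prod_Basis_vec) (simp add: less_imp_le)
  ultimately show ?thesis
    using lborel_affine_euclidean[of ?c "fst \<Theta>"] pos by (metis less_irrefl)
qed

text \<open>The Jacobian of \<open>stretch \<Theta>\<close> cancels the factor \<open>det A\<close>
  of the rescaled density, so that only \<open>g\<close> is left after the substitution.\<close>

lemma density_measure_rescaled:
  assumes "\<Theta> \<in> parameters" and [measurable]: "g \<in> borel_measurable borel"
  shows "density_measure (rescaled_density g \<Theta>) = distr (density_measure g) borel (stretch \<Theta>)"
proof -
  let ?p = "\<Prod>k\<in>UNIV. snd \<Theta> $ k" and ?f = "rescaled_density g \<Theta>"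
  have p: "?p > 0"
    using parameters_pos[OF assms(1)] by (simp add: prod_pos)
  have [measurable]: "?f \<in> borel_measurable borel"
    unfolding rescaled_density_eq by measurable
  have f: "?p * ?f (stretch \<Theta> y) = g y" for y
    using less_imp_neq[OF p] by (simp add: rescaled_density_eq rescaling_map_stretch[OF assms(1)] prod_dividef del: prod_zero_iff)
  have "density lborel ?f =
      density (density (distr lborel borel (stretch \<Theta>)) (\<lambda>_. ennreal ?p)) ?f"
    using lborel_stretch[OF assms(1)] by simp
  also have "\<dots> = density (distr lborel borel (stretch \<Theta>)) (\<lambda>x. ennreal (?p * ?f x))"
    using p by (subst density_density_eq) (auto simp: ennreal_mult')
  also have "\<dots> = distr (density lborel (\<lambda>y. ennreal (?p * ?f (stretch \<Theta> y)))) borel (stretch \<Theta>)"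
    by (subst density_distr) auto
  finally show ?thesis
    by (simp add: density_measure_def f)
qed

lemma transport_map_rescaling_map:
  assumes "\<Theta> \<in> parameters" "g \<in> borel_measurable borel"
  shows "transport_map (density_measure (rescaled_density g \<Theta>)) (density_measure g) (rescaling_map \<Theta>)"
proof -
  have "distr (distr (density_measure g) borel (stretch \<Theta>)) (density_measure g) (rescaling_map \<Theta>) =
      distr (density_measure g) (density_measure g) (\<lambda>y. y)"
    by (subst distr_distr) (auto simp: o_def rescaling_map_stretch[OF assms(1)])
  also have "\<dots> = density_measure g"
    by (rule distr_id)
  finally show ?thesis
    by (simp add: transport_map_def density_measure_rescaled[OF assms])
qed

section \<open>Integrability of quadratic polynomials\<close>

lemma integrable_coordinates:
  fixes M :: "(real ^ 'd) measure"
  assumes "finite_measure M" and [measurable_cong]: "sets M = sets borel"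
    and int: "integrable M (\<lambda>x. (norm x)\<^sup>2)"
  shows "integrable M (\<lambda>x. (x $ k)\<^sup>2)" "integrable M (\<lambda>x. x $ k)"
proof -
  interpret finite_measure M by fact
  have le: "(x $ k)\<^sup>2 \<le> (norm x)\<^sup>2" for x :: "real ^ 'd"
    using component_le_norm_cart[of x k] by (simp add: abs_le_square_iff[symmetric])
  show "integrable M (\<lambda>x. (x $ k)\<^sup>2)"
    by (rule Bochner_Integration.integrable_bound[OF int]) (auto simp: le)
  \<comment> \<open>From \<open>2 * t \<le> 1 + t^2\<close>; the constant 1 is integrable since the
    measure is finite.\<close>
  have le': "\<bar>x $ k\<bar> \<le> 1 + (norm x)\<^sup>2" for x :: "real ^ 'd"
    using le[of x] sum_squares_bound[of 1 "\<bar>x $ k\<bar>"] by simp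
  have "integrable M (\<lambda>x. 1 + (norm x)\<^sup>2)"
    using int by simp
  then show "integrable M (\<lambda>x. x $ k)"
    by (rule Bochner_Integration.integrable_bound) (auto intro!: order_trans[OF le'])
qed

lemma integrable_quadratic:
  fixes M :: "(real ^ 'd) measure" and a b c :: "'d \<Rightarrow> real"
  assumes "finite_measure M" "sets M = sets borel" "integrable M (\<lambda>x. (norm x)\<^sup>2)"
  shows "integrable M (\<lambda>x. \<Sum>k\<in>UNIV. a k * (x $ k)\<^sup>2 + b k * x $ k + c k)"
proof -
  interpret finite_measure M by fact
  show ?thesis
    by (intro Bochner_Integration.integrable_sum Bochner_Integration.integrable_add
        integrable_mult_right integrable_coordinates[OF assms] integrable_const)
qed

section \<open>Optimality and uniqueness of the transport map\<close>

text \<open>Completion of the square in each coordinate. The first two sums are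
  \<open>|x|^2 - 2 \<phi>(x)\<close> and \<open>|y|^2\<close> minus twice the Legendre transform of
  \<open>\<phi>\<close> at \<open>y\<close>; the third is twice the Fenchel defect.\<close>

lemma Fenchel_defect:
  fixes x y :: "real ^ 'd"
  assumes "\<Theta> \<in> parameters"
  shows "(norm (x - y))\<^sup>2 =
    (\<Sum>k\<in>UNIV. (x $ k)\<^sup>2 - (x $ k - fst \<Theta> $ k)\<^sup>2 / snd \<Theta> $ k) +
    (\<Sum>k\<in>UNIV. (y $ k)\<^sup>2 - (snd \<Theta> $ k * (y $ k)\<^sup>2 + 2 * fst \<Theta> $ k * y $ k)) +
    (\<Sum>k\<in>UNIV. snd \<Theta> $ k * (rescaling_map \<Theta> x $ k - y $ k)\<^sup>2)"
proof -
  have "(x $ k - y $ k)\<^sup>2 = ((x $ k)\<^sup>2 - (x $ k - fst \<Theta> $ k)\<^sup>2 / snd \<Theta> $ k)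
      + ((y $ k)\<^sup>2 - (snd \<Theta> $ k * (y $ k)\<^sup>2 + 2 * fst \<Theta> $ k * y $ k))
      + snd \<Theta> $ k * (rescaling_map \<Theta> x $ k - y $ k)\<^sup>2" for k
    using parameters_pos[OF assms, of k] by (simp add: field_simps power2_eq_square)
  then show ?thesis
    by (simp add: norm_power2_vec sum.distrib)
qed

text \<open>\<open>C\<close> is chosen before \<open>T\<close>: it collects the terms in
  \<open>x\<close> alone and in \<open>T x\<close> alone, whose integrals depend only on
  \<open>\<mu>\<close> and \<open>\<nu>\<close>. The nonnegativity clause matters because
  \<open>ennreal\<close> truncates negative reals to 0.\<close>

lemma transport_cost_decomposition:
  fixes \<mu> \<nu> :: "(real ^ 'd) measure"
  assumes \<Theta>: "\<Theta> \<in> parameters"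
    and \<mu>: "finite_measure \<mu>" "sets \<mu> = sets borel" "integrable \<mu> (\<lambda>x. (norm x)\<^sup>2)"
    and \<nu>: "finite_measure \<nu>" "sets \<nu> = sets borel" "integrable \<nu> (\<lambda>y. (norm y)\<^sup>2)"
  obtains C where
    "\<And>T. transport_map \<mu> \<nu> T \<Longrightarrow> integrable \<mu> (\<lambda>x. \<Sum>k\<in>UNIV. snd \<Theta> $ k * (rescaling_map \<Theta> x $ k - T x $ k)\<^sup>2)"
    "\<And>T. transport_map \<mu> \<nu> T \<Longrightarrow> C + (\<integral>x. (\<Sum>k\<in>UNIV. snd \<Theta> $ k * (rescaling_map \<Theta> x $ k - T x $ k)\<^sup>2) \<partial>\<mu>) \<ge> 0"
    "\<And>T. transport_map \<mu> \<nu> T \<Longrightarrow> transport_cost \<mu> T =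
      ennreal (C + (\<integral>x. (\<Sum>k\<in>UNIV. snd \<Theta> $ k * (rescaling_map \<Theta> x $ k - T x $ k)\<^sup>2) \<partial>\<mu>))"
proof -
  note [measurable_cong] = \<mu>(2) \<nu>(2)
  define a where "a x = (\<Sum>k\<in>UNIV. (x $ k)\<^sup>2 - (x $ k - fst \<Theta> $ k)\<^sup>2 / snd \<Theta> $ k)" for x :: "real ^ 'd"
  define b where "b y = (\<Sum>k\<in>UNIV. (y $ k)\<^sup>2 - (snd \<Theta> $ k * (y $ k)\<^sup>2 + 2 * fst \<Theta> $ k * y $ k))"
    for y :: "real ^ 'd"
  define C where "C = (\<integral>x. a x \<partial>\<mu>) + (\<integral>y. b y \<partial>\<nu>)"
  \<comment> \<open>Expansion into the shape that \<open>integrable_quadratic\<close>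
    expects.\<close>
  have "a = (\<lambda>x. \<Sum>k\<in>UNIV. (1 - 1 / snd \<Theta> $ k) * (x $ k)\<^sup>2
      + (2 * fst \<Theta> $ k / snd \<Theta> $ k) * x $ k + (- (fst \<Theta> $ k)\<^sup>2 / snd \<Theta> $ k))"
    unfolding a_def using parameters_pos[OF \<Theta>]
    by (intro ext sum.cong) (auto simp: field_simps power2_eq_square less_imp_neq[symmetric])
  then have int_a: "integrable \<mu> a"
    using integrable_quadratic[OF \<mu>] by presburger
  have "b = (\<lambda>y. \<Sum>k\<in>UNIV. (1 - snd \<Theta> $ k) * (y $ k)\<^sup>2 + (- 2 * fst \<Theta> $ k) * y $ k + 0)"
    unfolding b_def by (intro ext sum.cong) (auto simp: algebra_simps)
  then have int_b: "integrable \<nu> b"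
    using integrable_quadratic[OF \<nu>] by presburger
  have "integrable \<mu> (\<lambda>x. \<Sum>k\<in>UNIV. snd \<Theta> $ k * (rescaling_map \<Theta> x $ k - T x $ k)\<^sup>2) \<and>
    C + (\<integral>x. (\<Sum>k\<in>UNIV. snd \<Theta> $ k * (rescaling_map \<Theta> x $ k - T x $ k)\<^sup>2) \<partial>\<mu>) \<ge> 0 \<and>
    transport_cost \<mu> T =
      ennreal (C + (\<integral>x. (\<Sum>k\<in>UNIV. snd \<Theta> $ k * (rescaling_map \<Theta> x $ k - T x $ k)\<^sup>2) \<partial>\<mu>))"
    if T: "transport_map \<mu> \<nu> T" for T
  proof -
    let ?E = "\<lambda>x. \<Sum>k\<in>UNIV. snd \<Theta> $ k * (rescaling_map \<Theta> x $ k - T x $ k)\<^sup>2"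
    have T_meas: "T \<in> measurable \<mu> \<nu>" and T_distr: "distr \<mu> \<nu> T = \<nu>"
      using T by (auto simp: transport_map_def)
    have [measurable]: "T \<in> borel_measurable borel"
      using T_meas by (simp add: measurable_cong_sets[OF \<mu>(2) \<nu>(2)])
    have "integrable (distr \<mu> \<nu> T) (\<lambda>y. (norm y)\<^sup>2)" "integrable (distr \<mu> \<nu> T) b"
      using \<nu>(3) int_b by (simp_all add: T_distr)
    then have int_T: "integrable \<mu> (\<lambda>x. (norm (T x))\<^sup>2)" and int_bT: "integrable \<mu> (\<lambda>x. b (T x))"
      by (auto dest: integrable_distr[OF T_meas])
    have eq: "(norm (x - T x))\<^sup>2 = a x + b (T x) + ?E x" for x
      unfolding a_def b_def by (rule Fenchel_defect[OF \<Theta>])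
    have int_cost: "integrable \<mu> (\<lambda>x. (norm (x - T x))\<^sup>2)"
    proof (rule Bochner_Integration.integrable_bound)
      show "integrable \<mu> (\<lambda>x. 2 * (norm x)\<^sup>2 + 2 * (norm (T x))\<^sup>2)"
        using \<mu>(3) int_T by simp
      have "(norm (x - T x))\<^sup>2 \<le> 2 * (norm x)\<^sup>2 + 2 * (norm (T x))\<^sup>2" for x
      proof -
        \<comment> \<open>The parallelogram law; dropping the second square gives the bound.\<close>
        have "(norm (x - T x))\<^sup>2 + (norm (x + T x))\<^sup>2 = 2 * (norm x)\<^sup>2 + 2 * (norm (T x))\<^sup>2"
          unfolding power2_norm_eq_inner by (simp add: inner_simps inner_commute)
        then show ?thesis
          using zero_le_power2[of "norm (x + T x)"] by linarith
      qed
      then show "AE x in \<mu>. norm ((norm (x - T x))\<^sup>2) \<le> norm (2 * (norm x)\<^sup>2 + 2 * (norm (T x))\<^sup>2)"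
        by simp
    qed measurable
    \<comment> \<open>Integrability of the defect comes from solving the identity for it, as all
      other terms are already known to be integrable.\<close>
    have E: "?E = (\<lambda>x. (norm (x - T x))\<^sup>2 - a x - b (T x))"
      by (simp add: eq)
    have int_E: "integrable \<mu> ?E"
      unfolding E using int_cost int_a int_bT by simp
    have "(\<integral>y. b y \<partial>\<nu>) = (\<integral>y. b y \<partial>distr \<mu> \<nu> T)"
      by (simp add: T_distr)
    also have "\<dots> = (\<integral>x. b (T x) \<partial>\<mu>)"
      using int_b by (subst integral_distr) auto
    finally have "(\<integral>x. (norm (x - T x))\<^sup>2 \<partial>\<mu>) = C + (\<integral>x. ?E x \<partial>\<mu>)"
      unfolding eq C_def using int_a int_bT int_E by simp
    moreover have "transport_cost \<mu> T = ennreal (\<integral>x. (norm (x - T x))\<^sup>2 \<partial>\<mu>)"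
      unfolding transport_cost_def by (rule nn_integral_eq_integral[OF int_cost]) simp
    moreover have "(\<integral>x. (norm (x - T x))\<^sup>2 \<partial>\<mu>) \<ge> 0"
      by simp
    ultimately show ?thesis
      using int_E by simp
  qed
  then show thesis
    using that by blast
qed

text \<open>The cost of a transport map is \<open>C\<close> plus the integral of its defect, so a
  map is optimal only if that integral is 0, the value reached by
  \<open>rescaling_map \<Theta>\<close>.\<close>

lemma optimal_rescaling_map:
  fixes \<mu> \<nu> :: "(real ^ 'd) measure"
  assumes \<Theta>: "\<Theta> \<in> parameters"
    and \<mu>: "finite_measure \<mu>" "sets \<mu> = sets borel" "integrable \<mu> (\<lambda>x. (norm x)\<^sup>2)"
    and \<nu>: "finite_measure \<nu>" "sets \<nu> = sets borel" "integrable \<nu> (\<lambda>y. (norm y)\<^sup>2)"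
    and R: "transport_map \<mu> \<nu> (rescaling_map \<Theta>)"
  shows "optimal_transport_map \<mu> \<nu> (rescaling_map \<Theta>)"
    and "optimal_transport_map \<mu> \<nu> T \<Longrightarrow> AE x in \<mu>. T x = rescaling_map \<Theta> x"
proof -
  let ?E = "\<lambda>T x. \<Sum>k\<in>UNIV. snd \<Theta> $ k * (rescaling_map \<Theta> x $ k - T x $ k)\<^sup>2"
  obtain C where int: "\<And>T. transport_map \<mu> \<nu> T \<Longrightarrow> integrable \<mu> (?E T)"
    and nonneg: "\<And>T. transport_map \<mu> \<nu> T \<Longrightarrow> C + (\<integral>x. ?E T x \<partial>\<mu>) \<ge> 0"
    and cost: "\<And>T. transport_map \<mu> \<nu> T \<Longrightarrow> transport_cost \<mu> T = ennreal (C + (\<integral>x. ?E T x \<partial>\<mu>))"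
    using transport_cost_decomposition[OF \<Theta> \<mu> \<nu>] by blast
  have pos: "snd \<Theta> $ k > 0" for k
    by (rule parameters_pos[OF \<Theta>])
  have E_nonneg: "?E T x \<ge> 0" for T x
    using pos by (simp add: sum_nonneg less_imp_le)
  \<comment> \<open>\<open>rescaling_map \<Theta>\<close> has zero defect, so \<open>C\<close> is
    exactly its cost.\<close>
  have C: "C \<ge> 0" "transport_cost \<mu> (rescaling_map \<Theta>) = ennreal C"
    using nonneg[OF R] cost[OF R] by simp_all
  show "optimal_transport_map \<mu> \<nu> (rescaling_map \<Theta>)"
    unfolding optimal_transport_map_def
    using R E_nonneg by (auto simp: C cost intro!: ennreal_leI integral_nonneg)
  assume opt: "optimal_transport_map \<mu> \<nu> T"
  then have T: "transport_map \<mu> \<nu> T"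
    by (simp add: optimal_transport_map_def)
  have "transport_cost \<mu> T \<le> transport_cost \<mu> (rescaling_map \<Theta>)"
    using opt R by (simp add: optimal_transport_map_def)
  then have "(\<integral>x. ?E T x \<partial>\<mu>) \<le> 0"
    using C(1) by (simp add: C(2) cost[OF T] ennreal_le_iff)
  moreover have "(\<integral>x. ?E T x \<partial>\<mu>) \<ge> 0"
    by (rule Bochner_Integration.integral_nonneg) (rule E_nonneg)
  ultimately have "(\<integral>x. ?E T x \<partial>\<mu>) = 0"
    by simp
  then have "AE x in \<mu>. ?E T x = 0"
    using integral_nonneg_eq_0_iff_AE[OF int[OF T]] E_nonneg by simp
  then show "AE x in \<mu>. T x = rescaling_map \<Theta> x"
  proof (rule AE_mp, intro AE_I2 impI)
    fix x assume "?E T x = 0"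
    then have "snd \<Theta> $ k * (rescaling_map \<Theta> x $ k - T x $ k)\<^sup>2 = 0" for k
      using pos by (subst (asm) sum_nonneg_eq_0_iff) (auto simp: less_imp_le)
    then have "rescaling_map \<Theta> x $ k = T x $ k" for k
      using pos[of k] by (metis less_irrefl mult_eq_0_iff right_minus_eq zero_eq_power2)
    then show "T x = rescaling_map \<Theta> x"
      by (simp add: vec_eq_iff del: rescaling_map_nth)
  qed
qed

text \<open>The infimum is attained at an optimal map, and squaring undoes
  \<open>sqrt\<close>.\<close>

lemma wasserstein2_optimal:
  assumes "optimal_transport_map \<mu> \<nu> T"
  shows "(wasserstein2 \<mu> \<nu>)\<^sup>2 = enn2real (transport_cost \<mu> T)"
proof -
  have "(INF T \<in> {T. transport_map \<mu> \<nu> T}. transport_cost \<mu> T) = transport_cost \<mu> T"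
    using assms unfolding optimal_transport_map_def
    by (intro antisym INF_lower INF_greatest) auto
  then show ?thesis
    by (simp add: wasserstein2_def)
qed

section \<open>Positive definiteness of the quadratic part\<close>

text \<open>The exceptional set is a hyperplane if \<open>a\<close> is nonzero and empty otherwise;
  \<open>negligible_hyperplane\<close> covers both cases.\<close>

lemma AE_not_hyperplane:
  fixes a b :: real and k :: "'d::finite"
  assumes "a \<noteq> 0 \<or> b \<noteq> 0"
  shows "AE x in (lborel :: (real ^ 'd) measure). a * x $ k + b \<noteq> 0"
proof -
  let ?H = "{x :: real ^ 'd. (a *\<^sub>R axis k 1) \<bullet> x = - b}"
  have "a *\<^sub>R axis k 1 \<noteq> (0 :: real ^ 'd) \<or> - b \<noteq> 0"
    using assms by simp
  then have "negligible ?H"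
    by (rule negligible_hyperplane)
  \<comment> \<open>\<open>negligible\<close> refers to the completed measure; Borel measurability
    of \<open>?H\<close> brings nullity back to \<open>lborel\<close>.\<close>
  moreover have "?H \<in> sets lborel"
    using closed_hyperplane by auto
  ultimately have "?H \<in> null_sets lborel"
    by (simp add: negligible_iff_null_sets null_sets_completion_iff)
  then show ?thesis
    by (rule AE_I') (auto simp: inner_axis' algebra_simps)
qed

text \<open>Otherwise \<open>stretch \<Delta>\<close> vanishes almost everywhere on the set where
  \<open>g\<close> is positive. Some coordinate of it is a nonzero affine function, which vanishes
  only on a null set, so \<open>g\<close> would be 0 almost everywhere, against total mass
  1.\<close>

lemma quadratic_form_pos:
  fixes g :: "real ^ 'd \<Rightarrow> real"
  assumes g: "prob_density g" and int: "integrable (density_measure g) (\<lambda>y. (norm (stretch \<Delta> y))\<^sup>2)"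
    and "\<Delta> \<noteq> 0"
  shows "0 < (\<integral>y. (norm (stretch \<Delta> y))\<^sup>2 \<partial>density_measure g)"
proof (rule ccontr)
  have [measurable]: "g \<in> borel_measurable borel" and g_int: "(\<integral>\<^sup>+ x. ennreal (g x) \<partial>lborel) = 1"
    using g by (auto simp: prob_density_def)
  assume "\<not> ?thesis"
  moreover have "(\<integral>y. (norm (stretch \<Delta> y))\<^sup>2 \<partial>density_measure g) \<ge> 0"
    by simp
  ultimately have "(\<integral>y. (norm (stretch \<Delta> y))\<^sup>2 \<partial>density_measure g) = 0"
    by linarith
  then have "AE y in density_measure g. stretch \<Delta> y = 0"
    using integral_nonneg_eq_0_iff_AE[OF int] by simp
  then have *: "AE y in lborel. 0 < ennreal (g y) \<longrightarrow> stretch \<Delta> y = 0"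
    unfolding density_measure_def by (subst (asm) AE_density) auto
  obtain k where "snd \<Delta> $ k \<noteq> 0 \<or> fst \<Delta> $ k \<noteq> 0"
    using \<open>\<Delta> \<noteq> 0\<close> by (auto simp: prod_eq_iff vec_eq_iff)
  from * AE_not_hyperplane[OF this, of k] have "AE y in lborel. ennreal (g y) = 0"
    by eventually_elim (metis stretch_nth zero_index not_gr_zero)
  then have "(\<integral>\<^sup>+ x. ennreal (g x) \<partial>lborel) = 0"
    by (subst nn_integral_0_iff_AE) auto
  with g_int show False
    by simp
qed

section \<open>Strict convexity in the parameters\<close>

text \<open>Gives the exact gap in the convexity inequality, so that strictness survives
  integration.\<close>

lemma norm_convex_combination:
  fixes u v :: "'a::real_inner"
  shows "(norm ((1 - t) *\<^sub>R u + t *\<^sub>R v))\<^sup>2 =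
    (1 - t) * (norm u)\<^sup>2 + t * (norm v)\<^sup>2 - t * (1 - t) * (norm (u - v))\<^sup>2"
  by (simp add: power2_norm_eq_inner inner_diff_left inner_diff_right inner_add_left inner_add_right
      inner_commute[of v u] algebra_simps)

lemma convex_parameters: "convex (parameters :: ((real ^ 'd) \<times> (real ^ 'd)) set)"
proof -
  have "convex {l :: real ^ 'd. \<forall>k. 0 < l $ k}"
  proof (rule convexI, safe)
    fix x y :: "real ^ 'd" and u v :: real and k
    assume "\<forall>k. 0 < x $ k" "\<forall>k. 0 < y $ k" "0 \<le> u" "0 \<le> v" "u + v = 1"
    then show "0 < (u *\<^sub>R x + v *\<^sub>R y) $ k"
      \<comment> \<open>If \<open>u = 0\<close> then \<open>v = 1\<close>, and positivity comes from
        \<open>y\<close>.\<close>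
      by (cases "u = 0") (auto intro: add_pos_nonneg simp: less_imp_le)
  qed
  then show ?thesis
    unfolding parameters_def by (intro convex_Times convex_UNIV)
qed

lemma integrable_stretch:
  fixes M :: "(real ^ 'd) measure"
  assumes "finite_measure M" "sets M = sets borel" "integrable M (\<lambda>x. (norm x)\<^sup>2)"
  shows "integrable M (\<lambda>y. (norm (stretch \<Theta> y))\<^sup>2)"
    and "integrable M (\<lambda>y. (norm (stretch \<Theta> y - y))\<^sup>2)"
proof -
  have *: "integrable M (\<lambda>y. (norm (stretch \<Theta> y))\<^sup>2)" for \<Theta>
  proof -
    have "(\<lambda>y. (norm (stretch \<Theta> y))\<^sup>2) = (\<lambda>y. \<Sum>k\<in>UNIV. (snd \<Theta> $ k)\<^sup>2 * (y $ k)\<^sup>2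
        + (2 * snd \<Theta> $ k * fst \<Theta> $ k) * y $ k + (fst \<Theta> $ k)\<^sup>2)"
      by (simp add: norm_power2_vec power2_sum power_mult_distrib algebra_simps)
    then show ?thesis
      using integrable_quadratic[OF assms] by presburger
  qed
  show "integrable M (\<lambda>y. (norm (stretch \<Theta> y))\<^sup>2)"
    by (rule *)
  \<comment> \<open>Subtracting the identity lowers every scale by 1; here \<open>1\<close> is the
    all-ones vector.\<close>
  have "stretch \<Theta> y - y = stretch (fst \<Theta>, snd \<Theta> - 1) y" for y
    by (simp add: vec_eq_iff algebra_simps)
  then show "integrable M (\<lambda>y. (norm (stretch \<Theta> y - y))\<^sup>2)"
    using * by presburger
qed

text \<open>For fixed \<open>y\<close> the displacement \<open>stretch \<Theta> y - y\<close> is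
  affine in \<open>\<Theta>\<close>. The integrated gap is \<open>t * (1 - t)\<close> times the
  quadratic form at \<open>\<Theta> - \<Theta>'\<close>, which is positive.\<close>

lemma strictly_convex_stretch_cost:
  fixes g :: "real ^ 'd \<Rightarrow> real"
  assumes g: "prob_density g"
    and \<nu>: "finite_measure (density_measure g)" "integrable (density_measure g) (\<lambda>y. (norm y)\<^sup>2)"
    and S: "convex S"
  shows "strictly_convex_on S (\<lambda>\<Theta>. \<integral>y. (norm (stretch \<Theta> y - y))\<^sup>2 \<partial>density_measure g)"
  unfolding strictly_convex_on_def
proof (intro conjI S ballI allI impI, elim conjE)
  fix \<Theta> \<Theta>' :: "(real ^ 'd) \<times> (real ^ 'd)" and t :: real
  assume ne: "\<Theta> \<noteq> \<Theta>'" and t: "0 < t" "t < 1"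
  note int = integrable_stretch[OF \<nu>(1) sets_density_measure \<nu>(2)]
  let ?I = "\<lambda>\<Theta>. \<integral>y. (norm (stretch \<Theta> y - y))\<^sup>2 \<partial>density_measure g"
  let ?Q = "\<integral>y. (norm (stretch (\<Theta> - \<Theta>') y))\<^sup>2 \<partial>density_measure g"
  have "(norm (stretch ((1 - t) *\<^sub>R \<Theta> + t *\<^sub>R \<Theta>') y - y))\<^sup>2 =
      (1 - t) * (norm (stretch \<Theta> y - y))\<^sup>2 + t * (norm (stretch \<Theta>' y - y))\<^sup>2
      - t * (1 - t) * (norm (stretch (\<Theta> - \<Theta>') y))\<^sup>2" for y
  proof -
    have "stretch ((1 - t) *\<^sub>R \<Theta> + t *\<^sub>R \<Theta>') y - y =
        (1 - t) *\<^sub>R (stretch \<Theta> y - y) + t *\<^sub>R (stretch \<Theta>' y - y)"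
      by (simp add: vec_eq_iff algebra_simps)
    moreover have "stretch (\<Theta> - \<Theta>') y = (stretch \<Theta> y - y) - (stretch \<Theta>' y - y)"
      by (simp add: vec_eq_iff algebra_simps)
    ultimately show ?thesis
      by (simp only: norm_convex_combination)
  qed
  then have "?I ((1 - t) *\<^sub>R \<Theta> + t *\<^sub>R \<Theta>') = (1 - t) * ?I \<Theta> + t * ?I \<Theta>' - t * (1 - t) * ?Q"
    using int by simp
  moreover have "0 < t * (1 - t) * ?Q"
    using t ne quadratic_form_pos[OF g int(1)] by simp
  ultimately show "?I ((1 - t) *\<^sub>R \<Theta> + t *\<^sub>R \<Theta>') < (1 - t) * ?I \<Theta> + t * ?I \<Theta>'"
    by linarith
qed

section \<open>Optimal maps and squared distance for the family generated by
  \<open>g\<close>\<close>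

theorem theorem3p1:
  fixes g :: "real ^ 'd \<Rightarrow> real" and Y :: "(real ^ 'd) set"
  assumes "prob_density g"
    and "finite_second_moment g"
    and "convex Y"
    and "compact (closure {y. g y \<noteq> 0})"
    and "{y. g y \<noteq> 0} \<subseteq> Y"
  shows "(\<forall>\<Theta>\<in>parameters.
            optimal_transport_map (density_measure (rescaled_density g \<Theta>)) (density_measure g)
              (rescaling_map \<Theta>) \<and>
            (\<forall>T. optimal_transport_map (density_measure (rescaled_density g \<Theta>))
                   (density_measure g) T \<longrightarrow>
                 (AE x in density_measure (rescaled_density g \<Theta>). T x = rescaling_map \<Theta> x))) \<and>
         strictly_convex_on parameters
           (\<lambda>\<Theta>. (wasserstein2 (density_measure (rescaled_density g \<Theta>)) (density_measure g))\<^sup>2)"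
proof -
  let ?\<nu> = "density_measure g" and ?\<mu> = "\<lambda>\<Theta>. density_measure (rescaled_density g \<Theta>)"
  have g: "g \<in> borel_measurable borel" "\<And>x. 0 \<le> g x"
    using assms(1) by (auto simp: prob_density_def)
  note [measurable] = g(1)
  have fin_\<nu>: "finite_measure ?\<nu>"
    by (rule finite_measureI) (simp add: emeasure_density_measure_UNIV[OF assms(1)])
  then interpret finite_measure ?\<nu> .
  have int_\<nu>: "integrable ?\<nu> (\<lambda>y. (norm y)\<^sup>2)"
    using assms(2) g unfolding density_measure_def finite_second_moment_def
    by (subst integrable_density) (auto simp: mult.commute)
  note \<nu> = fin_\<nu> sets_density_measure int_\<nu>
  note int = integrable_stretch[OF \<nu>]
  have opt: "optimal_transport_map (?\<mu> \<Theta>) ?\<nu> (rescaling_map \<Theta>)"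
      "optimal_transport_map (?\<mu> \<Theta>) ?\<nu> T \<Longrightarrow> AE x in ?\<mu> \<Theta>. T x = rescaling_map \<Theta> x"
    if \<Theta>: "\<Theta> \<in> parameters" for \<Theta> T
  proof -
    note \<mu>_eq = density_measure_rescaled[OF \<Theta> g(1)]
    have "finite_measure (?\<mu> \<Theta>)"
      unfolding \<mu>_eq by (rule finite_measure_distr) simp
    moreover have "integrable (?\<mu> \<Theta>) (\<lambda>x. (norm x)\<^sup>2)"
      unfolding \<mu>_eq by (subst integrable_distr_eq) (auto intro: int)
    ultimately show "optimal_transport_map (?\<mu> \<Theta>) ?\<nu> (rescaling_map \<Theta>)"
      "optimal_transport_map (?\<mu> \<Theta>) ?\<nu> T \<Longrightarrow> AE x in ?\<mu> \<Theta>. T x = rescaling_map \<Theta> x"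
      using optimal_rescaling_map[OF \<Theta> _ sets_density_measure _ \<nu> transport_map_rescaling_map[OF \<Theta> g(1)]]
      by blast+
  qed
  have W: "(wasserstein2 (?\<mu> \<Theta>) ?\<nu>)\<^sup>2 = (\<integral>y. (norm (stretch \<Theta> y - y))\<^sup>2 \<partial>?\<nu>)"
    if \<Theta>: "\<Theta> \<in> parameters" for \<Theta>
  proof -
    \<comment> \<open>Substituting \<open>x = stretch \<Theta> y\<close> turns
      \<open>rescaling_map \<Theta> x\<close> into \<open>y\<close>.\<close>
    have "transport_cost (?\<mu> \<Theta>) (rescaling_map \<Theta>) = (\<integral>\<^sup>+ y. ennreal ((norm (stretch \<Theta> y - y))\<^sup>2) \<partial>?\<nu>)"
      unfolding transport_cost_def density_measure_rescaled[OF \<Theta> g(1)]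
      by (subst nn_integral_distr) (auto simp: rescaling_map_stretch[OF \<Theta>])
    also have "\<dots> = ennreal (\<integral>y. (norm (stretch \<Theta> y - y))\<^sup>2 \<partial>?\<nu>)"
      by (rule nn_integral_eq_integral[OF int(2)]) simp
    finally show ?thesis
      by (simp add: wasserstein2_optimal[OF opt(1)[OF \<Theta>]])
  qed
  have "strictly_convex_on parameters (\<lambda>\<Theta>. \<integral>y. (norm (stretch \<Theta> y - y))\<^sup>2 \<partial>?\<nu>)"
    by (rule strictly_convex_stretch_cost[OF assms(1) fin_\<nu> int_\<nu> convex_parameters])
  \<comment> \<open>Convex combinations stay in \<open>parameters\<close>, so \<open>W\<close>
    applies at all three points of the inequality.\<close>
  then have "strictly_convex_on parameters (\<lambda>\<Theta>. (wasserstein2 (?\<mu> \<Theta>) ?\<nu>)\<^sup>2)"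
    unfolding strictly_convex_on_def
    by (auto simp: W convexD_alt[OF convex_parameters])
  then show ?thesis
    using opt by blast
qed

end
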